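(* Let $d\ge1$ and let $\boldsymbol{f}\sim\mathcal{MGP}_d(\boldsymbol{u},k,\Lambda)$ be a $d$-variate Gaussian process indexed by $T$. If $$\boldsymbol{u}(t)=\boldsymbol{u}(t+h),\qquad k(t_s+h,t_l+h)=k(t_s,t_l)\qquad\text{for all } t,t_s,t_l,h\in T,$$ then $\boldsymbol{f}$ is strictly stationary.
   Context: The index set $T$ is closed under addition (e.g. $T=\mathbb{R}$, $\mathbb{R}^n$, $[0,\infty)$, $\mathbb{Z}$ or the non-negative integers). Here $\boldsymbol{u}:T\to\mathbb{R}^d$ (values are row vectors), $k:T\times T\to\mathbb{R}$ is a covariance function (symmetric, with all matrices $(k(t_i,t_j))_{i,j=1}^n$ positive semi-definite), and $\Lambda\in\mathbb{R}^{d\times d}$ is symmetric positive semi-definite. Matrix Gaussian distribution: an $n\times d$ random matrix $X$ satisfies $X\sim\mathcal{MN}(M,U,V)$, with $M\in\mathbb{R}^{n\times d}$, $U\in\mathbb{R}^{n\times n}$, $V\in\mathbb{R}^{d\times d}$, if and only if $\mathrm{vec}(X)\sim\mathcal{N}_{nd}(\mathrm{vec}(M),V\otimes U)$, where $\mathrm{vec}$ is vectorisation by stacking columns and $\otimes$ is the Kronecker product (degenerate Gaussians allowed). $\boldsymbol{f}\sim\mathcal{MGP}_d(\boldsymbol{u},k,\Lambda)$ means that $\boldsymbol{f}=(\boldsymbol{f}(t))_{t\in T}$ is an $\mathbb{R}^d$-valued process (row vectors) such that for all $n\ge1$ and $t_1,\dots,t_n\in T$, $$[\boldsymbol{f}(t_1)^{\mathsf{T}},\dots,\boldsymbol{f}(t_n)^{\mathsf{T}}]^{\mathsf{T}}\sim\mathcal{MN}\left([\boldsymbol{u}(t_1)^{\mathsf{T}},\dots,\boldsymbol{u}(t_n)^{\mathsf{T}}]^{\mathsf{T}},\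 (k(t_i,t_j))_{i,j=1}^n,\ \Lambda\right).$$ Strictly stationary means that for all $n\ge1$, $t_1,\dots,t_n\in T$ and $h\in T$, the random matrices $[\boldsymbol{f}(t_1+h)^{\mathsf{T}},\dots,\boldsymbol{f}(t_n+h)^{\mathsf{T}}]^{\mathsf{T}}$ and $[\boldsymbol{f}(t_1)^{\mathsf{T}},\dots,\boldsymbol{f}(t_n)^{\mathsf{T}}]^{\mathsf{T}}$ have the same distribution. *)

theory Defs
  imports "HOL-Probability.Probability" "Jordan_Normal_Form.Matrix"
begin

text \<open>Vectors and matrices are those of Jordan_Normal_Form, whose dimensions are terms; that theory
  has no topology on them, so their Borel \<sigma>-algebras are transported from the product
  \<sigma>-algebra on the entries.\<close>

definition borel_vec :: "nat \<Rightarrow> real Matrix.vec measure" where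
  "borel_vec m = vimage_algebra (carrier_vec m)
     (\<lambda>v. \<lambda>i\<in>{..<m}. vec_index v i) (\<Pi>\<^sub>M i\<in>{..<m}. borel)"

definition borel_mat :: "nat \<Rightarrow> nat \<Rightarrow> real mat measure" where
  "borel_mat n d = vimage_algebra (carrier_mat n d)
     (\<lambda>A. \<lambda>p\<in>{..<n} \<times> {..<d}. A $$ p) (\<Pi>\<^sub>M p\<in>{..<n} \<times> {..<d}. borel)"

definition psd_mat :: "nat \<Rightarrow> real mat \<Rightarrow> bool" where
  "psd_mat n A \<longleftrightarrow> A \<in> carrier_mat n n \<and> transpose_mat A = A \<and>
     (\<forall>x\<in>carrier_vec n. 0 \<le> scalar_prod x (A *\<^sub>v x))"

text \<open>Stacking of columns: entry (i, j) of an n-row matrix goes to position j * n + i.\<close>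

definition stack_cols :: "'a mat \<Rightarrow> 'a Matrix.vec" where
  "stack_cols A = Matrix.vec (dim_row A * dim_col A)
     (\<lambda>p. A $$ (p mod dim_row A, p div dim_row A))"

definition kronecker :: "'a::times mat \<Rightarrow> 'a mat \<Rightarrow> 'a mat" where
  "kronecker A B = mat (dim_row A * dim_row B) (dim_col A * dim_col B)
     (\<lambda>(p, q). A $$ (p div dim_row B, q div dim_col B) * B $$ (p mod dim_row B, q mod dim_col B))"

text \<open>The second parameter is the variance (assumed nonnegative), not the standard deviation.\<close>

definition normal_law :: "real \<Rightarrow> real \<Rightarrow> real measure" where
  "normal_law \<mu> v = (if v = 0 then return borel \<mu> else density lborel (normal_density \<mu> (sqrt v)))"

text \<open>Possibly degenerate multivariate Gaussians: a random vector is Gaussian with mean \<mu> and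
  covariance \<Sigma> if every linear combination of its coordinates with coefficients a is
  univariate Gaussian, with mean \<open>a\<^sup>T \<mu>\<close> and variance \<open>a\<^sup>T \<Sigma> a\<close>.\<close>

definition mv_normal ::
  "'w measure \<Rightarrow> ('w \<Rightarrow> real Matrix.vec) \<Rightarrow> real Matrix.vec \<Rightarrow> real mat \<Rightarrow> bool" where
  "mv_normal P X \<mu> \<Sigma> \<longleftrightarrow>
     X \<in> P \<rightarrow>\<^sub>M borel_vec (dim_vec \<mu>) \<and> psd_mat (dim_vec \<mu>) \<Sigma> \<and>
     (\<forall>a\<in>carrier_vec (dim_vec \<mu>).
        distr P borel (\<lambda>\<omega>. scalar_prod a (X \<omega>)) =
        normal_law (scalar_prod a \<mu>) (scalar_prod a (\<Sigma> *\<^sub>v a)))"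

definition matrix_normal ::
  "'w measure \<Rightarrow> ('w \<Rightarrow> real mat) \<Rightarrow> real mat \<Rightarrow> real mat \<Rightarrow> real mat \<Rightarrow> bool" where
  "matrix_normal P X M U V \<longleftrightarrow>
     X \<in> P \<rightarrow>\<^sub>M borel_mat (dim_row M) (dim_col M) \<and>
     U \<in> carrier_mat (dim_row M) (dim_row M) \<and> V \<in> carrier_mat (dim_col M) (dim_col M) \<and>
     mv_normal P (\<lambda>\<omega>. stack_cols (X \<omega>)) (stack_cols M) (kronecker V U)"

text \<open>Finite families of indices \<open>t\<^sub>1, \<dots>, t\<^sub>n\<close> in T are nonempty lists, possibly with repetitions.\<close>

definition gram_mat :: "('t \<Rightarrow> 't \<Rightarrow> real) \<Rightarrow> 't list \<Rightarrow> real mat" where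
  "gram_mat k ts = mat (length ts) (length ts) (\<lambda>(i, j). k (ts ! i) (ts ! j))"

definition covariance_function :: "'t set \<Rightarrow> ('t \<Rightarrow> 't \<Rightarrow> real) \<Rightarrow> bool" where
  "covariance_function T k \<longleftrightarrow>
     (\<forall>s\<in>T. \<forall>t\<in>T. k s t = k t s) \<and>
     (\<forall>ts. ts \<noteq> [] \<longrightarrow> set ts \<subseteq> T \<longrightarrow> psd_mat (length ts) (gram_mat k ts))"

definition vector_process ::
  "'w measure \<Rightarrow> 't set \<Rightarrow> nat \<Rightarrow> ('t \<Rightarrow> 'w \<Rightarrow> real Matrix.vec) \<Rightarrow> bool" where
  "vector_process P T d f \<longleftrightarrow> prob_space P \<and> (\<forall>t\<in>T. f t \<in> P \<rightarrow>\<^sub>M borel_vec d)"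

definition mgp ::
  "'w measure \<Rightarrow> 't set \<Rightarrow> nat \<Rightarrow> ('t \<Rightarrow> 'w \<Rightarrow> real Matrix.vec) \<Rightarrow>
   ('t \<Rightarrow> real Matrix.vec) \<Rightarrow> ('t \<Rightarrow> 't \<Rightarrow> real) \<Rightarrow> real mat \<Rightarrow> bool" where
  "mgp P T d f u k \<Lambda> \<longleftrightarrow> vector_process P T d f \<and>
     (\<forall>ts. ts \<noteq> [] \<longrightarrow> set ts \<subseteq> T \<longrightarrow>
        matrix_normal P (\<lambda>\<omega>. mat_of_rows d (map (\<lambda>t. f t \<omega>) ts))
          (mat_of_rows d (map u ts)) (gram_mat k ts) \<Lambda>)"

definition strictly_stationary ::
  "'w measure \<Rightarrow> 't::plus set \<Rightarrow> nat \<Rightarrow> ('t \<Rightarrow> 'w \<Rightarrow> real Matrix.vec) \<Rightarrow> bool" where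
  "strictly_stationary P T d f \<longleftrightarrow> vector_process P T d f \<and>
     (\<forall>ts h. ts \<noteq> [] \<longrightarrow> set ts \<subseteq> T \<longrightarrow> h \<in> T \<longrightarrow>
        distr P (borel_mat (length ts) d) (\<lambda>\<omega>. mat_of_rows d (map (\<lambda>t. f (t + h) \<omega>) ts)) =
        distr P (borel_mat (length ts) d) (\<lambda>\<omega>. mat_of_rows d (map (\<lambda>t. f t \<omega>) ts)))"

end

theory Submission
  imports Defs
begin

text \<open>Finite-dimensional distributions of a Gaussian process depend only on the mean vectors and
  covariance matrices, which are invariant under the shift. Since Gaussianity is expressed through
  linear combinations, this is the Cramer-Wold theorem. It is reduced to the one-dimensional Levy
  uniqueness theorem by replacing the factors \<open>e\<^sup>i\<^sup>a\<^sup>x\<close> of the joint characteristic function by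
  indicators of Borel sets, one coordinate at a time: the factors of the other coordinates act as a
  bounded complex weight.\<close>

section \<open>Uniqueness of weighted characteristic functions on the real line\<close>

text \<open>With \<open>c\<close> the total mass of the weight \<open>Y\<close>, this reads weighted
  integrals as integrals against the law of \<open>X\<close> under a reweighted measure. It serves
  twice: \<open>g = iexp (s * _)\<close> gives characteristic functions, and an indicator
  \<open>g\<close> gives probabilities.\<close>

lemma integral_distr_density:
  fixes X Y :: "'a \<Rightarrow> real" and g :: "real \<Rightarrow> 'b::{banach, second_countable_topology}"
  assumes [measurable]: "X \<in> borel_measurable M" "Y \<in> borel_measurable M" "g \<in> borel_measurable borel"
    and nn: "\<And>x. 0 \<le> Y x" and c: "0 < c"
  shows "integral\<^sup>L (distr (density M (\<lambda>x. Y x / c)) borel X) g = (1 / c) *\<^sub>R (LINT x|M. Y x *\<^sub>R g (X x))"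
proof -
  have "integral\<^sup>L (distr (density M (\<lambda>x. Y x / c)) borel X) g = (LINT x|M. (Y x / c) *\<^sub>R g (X x))"
    using nn c by (subst integral_distr) (simp_all add: integral_density)
  also have "\<dots> = (LINT x|M. (1 / c) *\<^sub>R (Y x *\<^sub>R g (X x)))"
    by simp
  finally show ?thesis
    by (simp only: integral_scaleR_right)
qed

text \<open>A nonnegative weight divided by its mass is a probability density. Under the reweighted
  measures, \<open>eq\<close> says that \<open>X\<close> and \<open>X'\<close> have the same
  characteristic function, so Levy uniqueness gives them the same law.\<close>

lemma weighted_char_unique_nonneg:
  fixes X Y :: "'a \<Rightarrow> real" and X' Y' :: "'b \<Rightarrow> real"
  assumes [measurable]: "X \<in> borel_measurable M" "X' \<in> borel_measurable N"
    and iY: "integrable M Y" "integrable N Y'"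
    and nn: "\<And>x. 0 \<le> Y x" "\<And>x. 0 \<le> Y' x"
    and eq: "\<And>s. (CLINT x|M. Y x *\<^sub>R iexp (s * X x)) = (CLINT x|N. Y' x *\<^sub>R iexp (s * X' x))"
    and A[measurable]: "A \<in> sets borel"
  shows "(LINT x|M. Y x * indicator A (X x)) = (LINT x|N. Y' x * indicator A (X' x))"
proof -
  have [measurable]: "Y \<in> borel_measurable M" "Y' \<in> borel_measurable N"
    using iY by auto
  define c where "c = (LINT x|M. Y x)"
  \<comment> \<open>At \<open>s = 0\<close> the exponential is 1, so both weights have the same mass
    and one constant \<open>c\<close> normalises both.\<close>
  have "complex_of_real (LINT x|M. Y x) = complex_of_real (LINT x|N. Y' x)"
    using eq[of 0] by (simp add: scaleR_conv_of_real integral_complex_of_real)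
  then have c': "c = (LINT x|N. Y' x)"
    unfolding c_def of_real_eq_iff .
  show ?thesis
  proof (cases "c = 0")
    case True
    \<comment> \<open>Mass zero cannot be normalised, but then both weights vanish almost
      everywhere.\<close>
    have "AE x in M. Y x = 0"
      using True iY(1) nn(1) by (simp add: c_def integral_nonneg_eq_0_iff_AE)
    moreover have "AE x in N. Y' x = 0"
      using True iY(2) nn(2) by (simp add: c' integral_nonneg_eq_0_iff_AE)
    ultimately have "(LINT x|M. Y x * indicator A (X x)) = 0" "(LINT x|N. Y' x * indicator A (X' x)) = 0"
      by (auto intro!: integral_eq_zero_AE)
    then show ?thesis by simp
  next
    case False
    then have c: "c > 0"
      using nn(1) by (simp add: c_def less_le integral_nonneg)
    define D where "D = density M (\<lambda>x. Y x / c)"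
    define E where "E = density N (\<lambda>x. Y' x / c)"
    have [measurable_cong]: "sets D = sets M" "sets E = sets N"
      by (auto simp: D_def E_def)
    have D: "prob_space D"
    proof
      have "(\<integral>\<^sup>+x. ennreal (Y x / c) \<partial>M) = ennreal (LINT x|M. Y x / c)"
        using iY(1) nn(1) c by (intro nn_integral_eq_integral) auto
      then show "emeasure D (space D) = 1"
        using c by (simp add: D_def emeasure_density cong: nn_integral_cong) (simp add: c_def)
    qed
    have E: "prob_space E"
    proof
      have "(\<integral>\<^sup>+x. ennreal (Y' x / c) \<partial>N) = ennreal (LINT x|N. Y' x / c)"
        using iY(2) nn(2) c by (intro nn_integral_eq_integral) auto
      then show "emeasure E (space E) = 1"
        using c by (simp add: E_def emeasure_density cong: nn_integral_cong) (simp add: c')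
    qed
    have "char (distr D borel X) = char (distr E borel X')"
    proof
      fix s
      have "char (distr D borel X) s = (1 / c) *\<^sub>R (CLINT x|M. Y x *\<^sub>R iexp (s * X x))"
        unfolding char_def D_def using nn(1) c by (intro integral_distr_density) auto
      also have "\<dots> = (1 / c) *\<^sub>R (CLINT x|N. Y' x *\<^sub>R iexp (s * X' x))"
        unfolding eq ..
      also have "\<dots> = char (distr E borel X') s"
        unfolding char_def E_def using nn(2) c by (intro integral_distr_density[symmetric]) auto
      finally show "char (distr D borel X) s = char (distr E borel X') s" .
    qed
    moreover have "real_distribution (distr D borel X)" "real_distribution (distr E borel X')"
      using D E by (auto intro!: prob_space.real_distribution_distr)
    ultimately have "distr D borel X = distr E borel X'"
      by (intro Levy_uniqueness)
    then have "(LINT y|distr D borel X. indicator A y) = (LINT y|distr E borel X'. indicator A y :: real)"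
      by simp
    moreover have "(LINT y|distr D borel X. indicator A y) = (1 / c) *\<^sub>R (LINT x|M. Y x *\<^sub>R indicator A (X x) :: real)"
      unfolding D_def using nn(1) c by (intro integral_distr_density) auto
    moreover have "(LINT y|distr E borel X'. indicator A y) = (1 / c) *\<^sub>R (LINT x|N. Y' x *\<^sub>R indicator A (X' x) :: real)"
      unfolding E_def using nn(2) c by (intro integral_distr_density) auto
    ultimately show ?thesis
      using c by simp
  qed
qed

text \<open>Signed weights are reduced to nonnegative ones. A constant added to the weight
  contributes unweighted integrals on both sides, and these agree because \<open>distr_eq\<close>
  equates the laws of \<open>X\<close> and \<open>X'\<close>.\<close>

lemma weighted_char_unique_real:
  fixes X Y :: "'a \<Rightarrow> real" and X' Y' :: "'b \<Rightarrow> real"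
  assumes "prob_space M" "prob_space N"
    and meas[measurable]: "X \<in> borel_measurable M" "X' \<in> borel_measurable N"
      "Y \<in> borel_measurable M" "Y' \<in> borel_measurable N"
    and bd: "\<And>x. \<bar>Y x\<bar> \<le> 1" "\<And>x. \<bar>Y' x\<bar> \<le> 1"
    and distr_eq: "distr M borel X = distr N borel X'"
    and eq: "\<And>s. (CLINT x|M. Y x *\<^sub>R iexp (s * X x)) = (CLINT x|N. Y' x *\<^sub>R iexp (s * X' x))"
    and A[measurable]: "A \<in> sets borel"
  shows "(LINT x|M. Y x * indicator A (X x)) = (LINT x|N. Y' x * indicator A (X' x))"
proof -
  interpret M: prob_space M by fact
  interpret N: prob_space N by fact
  have iY: "integrable M Y" "integrable N Y'"
    using bd by (auto intro!: M.integrable_const_bound[where B=1] N.integrable_const_bound[where B=1])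
  have iE: "integrable M (\<lambda>x. Y x *\<^sub>R iexp (s * X x))" "integrable M (\<lambda>x. iexp (s * X x))"
    "integrable N (\<lambda>x. Y' x *\<^sub>R iexp (s * X' x))" "integrable N (\<lambda>x. iexp (s * X' x))" for s
    using bd by (auto intro!: M.integrable_const_bound[where B=1] N.integrable_const_bound[where B=1])
  have iI: "integrable M (\<lambda>x. Y x * indicator A (X x))" "integrable M (\<lambda>x. indicator A (X x) :: real)"
    "integrable N (\<lambda>x. Y' x * indicator A (X' x))" "integrable N (\<lambda>x. indicator A (X' x) :: real)"
    using bd by (auto intro!: M.integrable_const_bound[where B=1] N.integrable_const_bound[where B=1]
      simp: indicator_def)
  have char_eq: "(CLINT x|M. iexp (s * X x)) = (CLINT x|N. iexp (s * X' x))" for s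
    using arg_cong[OF distr_eq, of "\<lambda>D. char D s"] by (simp add: char_def integral_distr)
  have ind_eq: "(LINT x|M. indicator A (X x) :: real) = (LINT x|N. indicator A (X' x))"
    using arg_cong[OF distr_eq, of "\<lambda>D. LINT y|D. indicator A y :: real"]
    by (simp only: integral_distr[OF meas(1) borel_measurable_indicator[OF A]]
        integral_distr[OF meas(2) borel_measurable_indicator[OF A]])
  \<comment> \<open>shift the weights by 1 to make them nonnegative\<close>
  have "(LINT x|M. (1 + Y x) * indicator A (X x)) = (LINT x|N. (1 + Y' x) * indicator A (X' x))"
  proof (rule weighted_char_unique_nonneg[OF _ _ _ _ _ _ _ A])
    show "0 \<le> 1 + Y x" for x using bd(1)[of x] by linarith
    show "0 \<le> 1 + Y' x" for x using bd(2)[of x] by linarith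
    show "(CLINT x|M. (1 + Y x) *\<^sub>R iexp (s * X x)) = (CLINT x|N. (1 + Y' x) *\<^sub>R iexp (s * X' x))" for s
      by (simp only: scaleR_add_left scaleR_one Bochner_Integration.integral_add[OF iE(2,1)]
          Bochner_Integration.integral_add[OF iE(4,3)] eq char_eq)
  qed (use iY in auto)
  then show ?thesis
    by (simp only: distrib_right mult_1 Bochner_Integration.integral_add[OF iI(2,1)]
        Bochner_Integration.integral_add[OF iI(4,3)] ind_eq add_left_cancel)
qed

text \<open>Conjugation turns \<open>s\<close> into \<open>-s\<close>, so the hypothesis passes to the real and imaginary parts of
  the weights.\<close>

lemma weighted_char_unique:
  fixes X :: "'a \<Rightarrow> real" and X' :: "'b \<Rightarrow> real" and Y :: "'a \<Rightarrow> complex" and Y' :: "'b \<Rightarrow> complex"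
  assumes M: "prob_space M" and N: "prob_space N"
    and meas[measurable]: "X \<in> borel_measurable M" "X' \<in> borel_measurable N"
      "Y \<in> borel_measurable M" "Y' \<in> borel_measurable N"
    and bd: "\<And>x. norm (Y x) \<le> 1" "\<And>x. norm (Y' x) \<le> 1"
    and distr_eq: "distr M borel X = distr N borel X'"
    and eq: "\<And>s. (CLINT x|M. Y x * iexp (s * X x)) = (CLINT x|N. Y' x * iexp (s * X' x))"
    and A[measurable]: "A \<in> sets borel"
  shows "(CLINT x|M. Y x * indicator A (X x)) = (CLINT x|N. Y' x * indicator A (X' x))"
proof -
  interpret M: prob_space M by fact
  interpret N: prob_space N by fact
  have cnj_meas[measurable]: "(\<lambda>x. cnj (Y x)) \<in> borel_measurable M" "(\<lambda>x. cnj (Y' x)) \<in> borel_measurable N"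
    by (rule measurable_compose[OF _ borel_measurable_continuous_onI[OF continuous_on_cnj[OF continuous_on_id]]], measurable)+
  have iE: "integrable M (\<lambda>x. Y x * iexp (s * X x))" "integrable M (\<lambda>x. cnj (Y x) * iexp (s * X x))"
    "integrable N (\<lambda>x. Y' x * iexp (s * X' x))" "integrable N (\<lambda>x. cnj (Y' x) * iexp (s * X' x))" for s
    using bd by (auto intro!: M.integrable_const_bound[where B=1] N.integrable_const_bound[where B=1]
      simp: norm_mult)
  have iI: "integrable M (\<lambda>x. Y x * indicator A (X x))" "integrable N (\<lambda>x. Y' x * indicator A (X' x))"
    using bd by (auto intro!: M.integrable_const_bound[where B=1] N.integrable_const_bound[where B=1]
      simp: indicator_def)
  have "(CLINT x|M. cnj (Y x) * iexp (s * X x)) = cnj (CLINT x|M. Y x * iexp (-s * X x))"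
    "(CLINT x|N. cnj (Y' x) * iexp (s * X' x)) = cnj (CLINT x|N. Y' x * iexp (-s * X' x))" for s
    by (simp_all add: exp_cnj flip: Bochner_Integration.integral_cnj)
  then have cnj_eq: "(CLINT x|M. cnj (Y x) * iexp (s * X x)) = (CLINT x|N. cnj (Y' x) * iexp (s * X' x))" for s
    by (simp only: eq)
  \<comment> \<open>These identities express the integrals with real weights through those with
    weights \<open>Y\<close> and \<open>cnj Y\<close>.\<close>
  have re: "Re z *\<^sub>R w = (1 / 2) * (z * w + cnj z * w)" for z w
    by (simp add: complex_eq_iff)
  have im: "Im z *\<^sub>R w = (- \<i> / 2) * (z * w - cnj z * w)" for z w
    by (simp add: complex_eq_iff)
  have "(CLINT x|M. Re (Y x) *\<^sub>R iexp (s * X x)) = (CLINT x|N. Re (Y' x) *\<^sub>R iexp (s * X' x))" for s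
    by (simp only: re integral_mult_right_zero Bochner_Integration.integral_add[OF iE(1,2)]
        Bochner_Integration.integral_add[OF iE(3,4)] eq cnj_eq)
  then have Re_eq: "(LINT x|M. Re (Y x) * indicator A (X x)) = (LINT x|N. Re (Y' x) * indicator A (X' x))"
    by (intro weighted_char_unique_real M N distr_eq A)
      (auto intro: order_trans[OF abs_Re_le_cmod bd(1)] order_trans[OF abs_Re_le_cmod bd(2)])
  have "(CLINT x|M. Im (Y x) *\<^sub>R iexp (s * X x)) = (CLINT x|N. Im (Y' x) *\<^sub>R iexp (s * X' x))" for s
    by (simp only: im integral_mult_right_zero Bochner_Integration.integral_diff[OF iE(1,2)]
        Bochner_Integration.integral_diff[OF iE(3,4)] eq cnj_eq)
  then have Im_eq: "(LINT x|M. Im (Y x) * indicator A (X x)) = (LINT x|N. Im (Y' x) * indicator A (X' x))"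
    by (intro weighted_char_unique_real M N distr_eq A)
      (auto intro: order_trans[OF abs_Im_le_cmod bd(1)] order_trans[OF abs_Im_le_cmod bd(2)])
  have ind: "Re (z * indicator A y) = Re z * indicator A y" "Im (z * indicator A y) = Im z * indicator A y"
    for z and y :: real
    by (auto simp: indicator_def)
  show ?thesis
    by (rule complex_eqI)
      (simp_all only: integral_Re[OF iI(1), symmetric] integral_Re[OF iI(2), symmetric]
        integral_Im[OF iI(1), symmetric] integral_Im[OF iI(2), symmetric] ind Re_eq Im_eq)
qed

section \<open>The Cramer-Wold theorem on finite products of the real line\<close>

theorem Cramer_Wold_PiM:
  fixes M N :: "('i \<Rightarrow> real) measure"
  assumes I: "finite I" and M: "prob_space M" and N: "prob_space N"
    and sets_M[measurable_cong]: "sets M = sets (PiM I (\<lambda>_. borel))"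
    and sets_N[measurable_cong]: "sets N = sets (PiM I (\<lambda>_. borel))"
    and eq: "\<And>a. distr M borel (\<lambda>x. \<Sum>i\<in>I. a i * x i) = distr N borel (\<lambda>x. \<Sum>i\<in>I. a i * x i)"
  shows "M = N"
proof -
  interpret M: prob_space M by fact
  interpret N: prob_space N by fact
  have space: "space M = PiE I (\<lambda>_. UNIV)" "space N = PiE I (\<lambda>_. UNIV)"
    using sets_M sets_N by (auto dest!: sets_eq_imp_space_eq simp: space_PiM)
  \<comment> \<open>Coordinates in \<open>J\<close> enter through indicators, the remaining ones
    through exponentials. Enlarging \<open>J\<close> from the empty set to \<open>I\<close> leads
    from the joint characteristic function to the probabilities of boxes.\<close>
  have mixed: "(CLINT x|M. (\<Prod>i\<in>J. indicator (A i) (x i)) * iexp (\<Sum>i\<in>I - J. a i * x i)) =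
        (CLINT x|N. (\<Prod>i\<in>J. indicator (A i) (x i)) * iexp (\<Sum>i\<in>I - J. a i * x i))"
    if "J \<subseteq> I" and A: "\<And>i. i \<in> I \<Longrightarrow> A i \<in> sets borel" for A :: "'i \<Rightarrow> real set" and J a
  proof -
    have "finite J" using that(1) I by (rule finite_subset)
    from this that(1) show ?thesis
    \<comment> \<open>The coefficients stay arbitrary because the step uses the induction hypothesis
      at \<open>a(j := s)\<close> for every \<open>s\<close>.\<close>
    proof (induction arbitrary: a rule: finite_induct)
      case empty
      \<comment> \<open>The joint characteristic function at \<open>a\<close> is that of the linear
        combination with coefficients \<open>a\<close>, evaluated at 1.\<close>
      show ?case
        using arg_cong[OF eq[of a], of "\<lambda>D. char D 1"] by (simp add: char_def integral_distr)
    next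
      case (insert j J)
      have j: "j \<in> I" "J \<subseteq> I" using insert.prems by auto
      have [measurable]: "A i \<in> sets borel" if "i \<in> insert j J" for i
        using that insert.prems by (intro A) auto
      have Aj: "A j \<in> sets borel" using j A by auto
      have comp: "(\<lambda>x. x i) \<in> borel_measurable M" "(\<lambda>x. x i) \<in> borel_measurable N" if "i \<in> I" for i
        using that by measurable
      \<comment> \<open>The weight collects all coordinates other than \<open>j\<close>. Multiplied
        by \<open>iexp (s * x j)\<close>, it becomes the integrand for \<open>J\<close> in which
        coordinate \<open>j\<close> has coefficient \<open>s\<close>.\<close>
      let ?Y = "\<lambda>x. (\<Prod>i\<in>J. indicator (A i) (x i)) * iexp (\<Sum>i\<in>I - insert j J. a i * x i)"
      have split: "?Y x * iexp (s * x j) =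
          (\<Prod>i\<in>J. indicator (A i) (x i)) * iexp (\<Sum>i\<in>I - J. (a(j := s)) i * x i)" for s x
      proof -
        have I_J: "I - J = insert j (I - insert j J)" using j insert.hyps by auto
        have "(\<Sum>i\<in>I - J. (a(j := s)) i * x i) = s * x j + (\<Sum>i\<in>I - insert j J. (a(j := s)) i * x i)"
          unfolding I_J using I by (subst sum.insert) auto
        also have "(\<Sum>i\<in>I - insert j J. (a(j := s)) i * x i) = (\<Sum>i\<in>I - insert j J. a i * x i)"
          by (rule sum.cong) auto
        finally show ?thesis
          by (simp only: of_real_add distrib_left exp_add mult.assoc mult.commute mult.left_commute)
      qed
      have bd: "norm (?Y x) \<le> 1" for x
      proof -
        have "(\<Prod>i\<in>J. norm (indicator (A i) (x i) :: complex)) \<le> (\<Prod>i\<in>J. 1)"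
          by (intro prod_mono) (auto simp: indicator_def)
        then show ?thesis by (simp add: norm_mult prod_norm del: of_real_sum)
      qed
      have ind: "(\<lambda>x. indicator (A i) (x i) :: complex) \<in> borel_measurable M"
          "(\<lambda>x. indicator (A i) (x i) :: complex) \<in> borel_measurable N" if "i \<in> J" for i
        using that j(2) A[of i] comp[of i] by (auto intro: measurable_compose)
      \<comment> \<open>The coefficients of the \<open>j\<close>-th unit vector give equality of the
        marginals, as the weighted uniqueness lemma demands.\<close>
      have "distr M borel (\<lambda>x. x j) = distr N borel (\<lambda>x. x j)"
        using eq[of "\<lambda>i. if i = j then 1 else 0"] I j by (simp add: if_distrib[of "\<lambda>c. c * _"] cong: if_cong)
      moreover have "?Y \<in> borel_measurable M" "?Y \<in> borel_measurable N"
        using j(2) by (intro borel_measurable_times borel_measurable_prod ind; measurable; auto intro: comp)+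
      moreover have "(CLINT x|M. ?Y x * iexp (s * x j)) = (CLINT x|N. ?Y x * iexp (s * x j))" for s
        unfolding split by (rule insert.IH[OF j(2)])
      ultimately have "(CLINT x|M. ?Y x * indicator (A j) (x j)) = (CLINT x|N. ?Y x * indicator (A j) (x j))"
        using bd by (intro weighted_char_unique M N comp j(1) Aj)
      moreover have "(\<Prod>i\<in>insert j J. indicator (A i) (x i)) * iexp (\<Sum>i\<in>I - insert j J. a i * x i) =
          ?Y x * indicator (A j) (x j)" for x
        by (simp only: prod.insert[OF insert.hyps] mult.assoc mult.commute mult.left_commute)
      ultimately show ?case
        by (simp only:)
    qed
  qed
  have box: "emeasure M (PiE I A) = emeasure N (PiE I A)" if A: "\<And>i. i \<in> I \<Longrightarrow> A i \<in> sets borel" for A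
  proof -
    \<comment> \<open>Membership in a box also requires being extensional, so the product formula is
      stated only on the space of the measures.\<close>
    have ind: "complex_of_real (indicator (PiE I A) x) = (\<Prod>i\<in>I. indicator (A i) (x i))"
      if "x \<in> PiE I (\<lambda>_. UNIV)" for x
      using that I by (auto simp: indicator_def PiE_iff)
    have "(CLINT x|M. complex_of_real (indicator (PiE I A) x)) = (CLINT x|M. \<Prod>i\<in>I. indicator (A i) (x i))"
      by (rule Bochner_Integration.integral_cong[OF refl ind]) (simp add: space)
    also have "\<dots> = (CLINT x|N. \<Prod>i\<in>I. indicator (A i) (x i))"
      using mixed[of I A] A by simp
    also have "\<dots> = (CLINT x|N. complex_of_real (indicator (PiE I A) x))"
      by (rule Bochner_Integration.integral_cong[OF refl ind[symmetric]]) (simp add: space)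
    finally have "(LINT x|M. indicator (PiE I A) x :: real) = (LINT x|N. indicator (PiE I A) x)"
      unfolding integral_complex_of_real of_real_eq_iff .
    moreover have "PiE I A \<in> sets M" "PiE I A \<in> sets N"
      using A I by (auto simp: sets_M sets_N)
    ultimately show ?thesis
      by (simp add: M.emeasure_eq_measure N.emeasure_eq_measure)
  qed
  \<comment> \<open>Boxes form an intersection-stable generator. The constant sequence of the whole
    space serves as the exhausting sequence of sets of finite measure.\<close>
  show ?thesis
  proof (rule measure_eqI_PiM_finite[OF I sets_M sets_N])
    show "range (\<lambda>_::nat. PiE I (\<lambda>_. UNIV)) \<subseteq> prod_algebra I (\<lambda>_. borel)"
      using I by (auto intro!: prod_algebraI_finite)
  qed (use box in \<open>auto simp: space_PiM\<close>)
qed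

section \<open>Uniqueness of the matrix Gaussian law\<close>

text \<open>Every measurable set of the pulled-back algebra is a preimage under \<phi>, so the law
  of \<open>\<phi> (X \<omega>)\<close> already determines that of \<open>X\<close>. Applied to the
  entry map, it carries uniqueness from products over to matrices.\<close>

lemma distr_vimage_algebra_eqI:
  assumes X: "X \<in> P \<rightarrow>\<^sub>M vimage_algebra S \<phi> K" "Y \<in> Q \<rightarrow>\<^sub>M vimage_algebra S \<phi> K"
    and \<phi>: "\<phi> \<in> S \<rightarrow> space K"
    and eq: "distr P K (\<lambda>\<omega>. \<phi> (X \<omega>)) = distr Q K (\<lambda>\<omega>. \<phi> (Y \<omega>))"
  shows "distr P (vimage_algebra S \<phi> K) X = distr Q (vimage_algebra S \<phi> K) Y"
proof (rule measure_eqI)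
  fix C assume "C \<in> sets (distr P (vimage_algebra S \<phi> K) X)"
  then have C: "C \<in> sets (vimage_algebra S \<phi> K)" by simp
  then obtain B where B: "B \<in> sets K" and CB: "C = \<phi> -` B \<inter> S"
    unfolding sets_vimage_algebra2[OF \<phi>] by auto
  note \<phi>m = measurable_vimage_algebra1[OF \<phi>]
  \<comment> \<open>Since \<open>X\<close> and \<open>Y\<close> take values in \<open>S\<close>,
    intersecting with \<open>S\<close> removes nothing.\<close>
  have "X -` C \<inter> space P = (\<lambda>\<omega>. \<phi> (X \<omega>)) -` B \<inter> space P"
    "Y -` C \<inter> space Q = (\<lambda>\<omega>. \<phi> (Y \<omega>)) -` B \<inter> space Q"
    using measurable_space[OF X(1)] measurable_space[OF X(2)] by (auto simp: CB)
  moreover have "emeasure P ((\<lambda>\<omega>. \<phi> (X \<omega>)) -` B \<inter> space P) = emeasure Q ((\<lambda>\<omega>. \<phi> (Y \<omega>)) -` B \<inter> space Q)"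
    using arg_cong[OF eq, of "\<lambda>D. emeasure D B"] B
    by (simp add: emeasure_distr measurable_compose[OF X(1) \<phi>m] measurable_compose[OF X(2) \<phi>m])
  ultimately show "emeasure (distr P (vimage_algebra S \<phi> K) X) C = emeasure (distr Q (vimage_algebra S \<phi> K) Y) C"
    using C X by (simp add: emeasure_distr)
qed simp

text \<open>Column stacking is the bijection sending \<open>(i, j)\<close> to
  \<open>j * n + i\<close>, with inverse \<open>q\<close> to \<open>(q mod n, q div n)\<close>. The
  identity matches linear combinations of entries with those in \<open>mv_normal\<close>.\<close>

lemma scalar_prod_stack_cols:
  fixes A :: "real mat"
  assumes A: "A \<in> carrier_mat n d"
  shows "scalar_prod (stack_cols (mat n d a)) (stack_cols A) = (\<Sum>p\<in>{..<n} \<times> {..<d}. a p * A $$ p)"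
proof -
  have dims: "dim_row A = n" "dim_col A = d" using A by auto
  have "(\<Sum>p\<in>{..<n} \<times> {..<d}. a p * A $$ p) =
      (\<Sum>q\<in>{0..<n * d}. a (q mod n, q div n) * A $$ (q mod n, q div n))"
  proof (rule sum.reindex_bij_witness[of _ "\<lambda>q. (q mod n, q div n)" "\<lambda>(i, j). j * n + i"])
    fix p assume p: "p \<in> {..<n} \<times> {..<d}"
    obtain i j where ij: "p = (i, j)" "i < n" "j < d" using p by auto
    have "j * n + i < Suc j * n" using ij by simp
    also have "\<dots> \<le> d * n" using ij by (intro mult_le_mono1) simp
    finally show "(case p of (i, j) \<Rightarrow> j * n + i) \<in> {0..<n * d}"
      using ij by (simp add: mult.commute)
  next
    fix q assume q: "q \<in> {0..<n * d}"
    \<comment> \<open>For \<open>n = 0\<close> the range of \<open>q\<close> would be empty;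
      positivity makes \<open>q mod n\<close> a valid row index.\<close>
    then have "n > 0" by (cases n) auto
    then show "(q mod n, q div n) \<in> {..<n} \<times> {..<d}"
      using q by (simp add: less_mult_imp_div_less mult.commute)
  qed auto
  also have "\<dots> = scalar_prod (stack_cols (mat n d a)) (stack_cols A)"
    unfolding scalar_prod_def
  proof (rule sum.cong)
    fix q assume q: "q \<in> {0..<dim_vec (stack_cols A)}"
    then have q: "q < n * d" by (simp add: stack_cols_def dims)
    then have "n > 0" by (cases n) auto
    then have "q mod n < n" "q div n < d"
      using q by (simp_all add: less_mult_imp_div_less mult.commute)
    then show "a (q mod n, q div n) * A $$ (q mod n, q div n) =
        vec_index (stack_cols (mat n d a)) q * vec_index (stack_cols A) q"
      using q by (simp add: stack_cols_def dims)
  qed (simp add: stack_cols_def dims)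
  finally show ?thesis ..
qed

text \<open>The point is the right-hand side: it depends on \<open>M\<close>, \<open>U\<close>,
  \<open>V\<close> and \<open>a\<close> alone, not on \<open>P\<close> or \<open>X\<close>.\<close>

lemma matrix_normal_linear_combination:
  assumes M: "M \<in> carrier_mat n d" and X: "matrix_normal P X M U V"
  shows "distr P borel (\<lambda>\<omega>. \<Sum>p\<in>{..<n} \<times> {..<d}. a p * X \<omega> $$ p) =
      normal_law (scalar_prod (stack_cols (mat n d a)) (stack_cols M))
        (scalar_prod (stack_cols (mat n d a)) (kronecker V U *\<^sub>v stack_cols (mat n d a)))"
proof -
  have dims: "dim_row M = n" "dim_col M = d" "dim_vec (stack_cols M) = n * d"
    using M by (auto simp: stack_cols_def)
  have "X \<in> P \<rightarrow>\<^sub>M borel_mat n d"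
    using X by (simp add: matrix_normal_def dims)
  then have "X \<omega> \<in> carrier_mat n d" if "\<omega> \<in> space P" for \<omega>
    using that measurable_space[of X P "borel_mat n d" \<omega>] by (simp add: borel_mat_def)
  then have "distr P borel (\<lambda>\<omega>. \<Sum>p\<in>{..<n} \<times> {..<d}. a p * X \<omega> $$ p) =
      distr P borel (\<lambda>\<omega>. scalar_prod (stack_cols (mat n d a)) (stack_cols (X \<omega>)))"
    by (intro distr_cong) (simp_all only: scalar_prod_stack_cols)
  moreover have "stack_cols (mat n d a) \<in> carrier_vec (n * d)"
    by (rule carrier_vecI) (simp add: stack_cols_def)
  moreover have "mv_normal P (\<lambda>\<omega>. stack_cols (X \<omega>)) (stack_cols M) (kronecker V U)"
    using X unfolding matrix_normal_def by blast
  ultimately show ?thesis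
    unfolding mv_normal_def dims by metis
qed

text \<open>All linear combinations of the entries have the same law under both models, so
  Cramer-Wold identifies the laws of the entry families.\<close>

lemma matrix_normal_distr_unique:
  assumes P: "prob_space P" and Q: "prob_space Q" and M: "M \<in> carrier_mat n d"
    and X: "matrix_normal P X M U V" and Y: "matrix_normal Q Y M U V"
  shows "distr P (borel_mat n d) X = distr Q (borel_mat n d) Y"
proof -
  let ?I = "{..<n} \<times> {..<d}"
  let ?\<phi> = "\<lambda>A::real mat. \<lambda>p\<in>?I. A $$ p"
  let ?K = "\<Pi>\<^sub>M p\<in>?I. (borel :: real measure)"
  have dims: "dim_row M = n" "dim_col M = d" "dim_vec (stack_cols M) = n * d"
    using M by (auto simp: stack_cols_def)
  have meas: "X \<in> P \<rightarrow>\<^sub>M vimage_algebra (carrier_mat n d) ?\<phi> ?K"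
    "Y \<in> Q \<rightarrow>\<^sub>M vimage_algebra (carrier_mat n d) ?\<phi> ?K"
    using X Y by (simp_all add: matrix_normal_def dims borel_mat_def)
  have \<phi>: "?\<phi> \<in> carrier_mat n d \<rightarrow> space ?K"
    by (auto simp: space_PiM)
  have \<phi>_meas: "(\<lambda>\<omega>. ?\<phi> (X \<omega>)) \<in> P \<rightarrow>\<^sub>M ?K" "(\<lambda>\<omega>. ?\<phi> (Y \<omega>)) \<in> Q \<rightarrow>\<^sub>M ?K"
    using measurable_compose[OF meas(1) measurable_vimage_algebra1[OF \<phi>]]
      measurable_compose[OF meas(2) measurable_vimage_algebra1[OF \<phi>]] by auto
  \<comment> \<open>The sum runs over \<open>?I\<close> only, so it does not see the restriction in
    the entry map.\<close>
  have restr: "(\<Sum>p\<in>?I. a p * ?\<phi> A p) = (\<Sum>p\<in>?I. a p * A $$ p)" for a A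
    by (rule sum.cong) auto
  have "distr P ?K (\<lambda>\<omega>. ?\<phi> (X \<omega>)) = distr Q ?K (\<lambda>\<omega>. ?\<phi> (Y \<omega>))"
  proof (rule Cramer_Wold_PiM[where I = ?I])
    fix a
    have s: "(\<lambda>x. \<Sum>i\<in>?I. a i * x i) \<in> borel_measurable ?K" by measurable
    show "distr (distr P ?K (\<lambda>\<omega>. ?\<phi> (X \<omega>))) borel (\<lambda>x. \<Sum>i\<in>?I. a i * x i) =
        distr (distr Q ?K (\<lambda>\<omega>. ?\<phi> (Y \<omega>))) borel (\<lambda>x. \<Sum>i\<in>?I. a i * x i)"
      unfolding distr_distr[OF s \<phi>_meas(1)] distr_distr[OF s \<phi>_meas(2)] comp_def restr
        matrix_normal_linear_combination[OF M X] matrix_normal_linear_combination[OF M Y] ..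
  qed (use P Q \<phi>_meas in \<open>auto intro: prob_space.prob_space_distr\<close>)
  then show ?thesis
    unfolding borel_mat_def by (rule distr_vimage_algebra_eqI[OF meas \<phi>])
qed

section \<open>Strict stationarity of the Gaussian process\<close>

theorem proposition3p1:
  fixes P :: "'w measure"
    and T :: "'t::ab_semigroup_add set"
    and d :: nat
    and f :: "'t \<Rightarrow> 'w \<Rightarrow> real Matrix.vec"
    and u :: "'t \<Rightarrow> real Matrix.vec"
    and k :: "'t \<Rightarrow> 't \<Rightarrow> real"
    and \<Lambda> :: "real mat"
  assumes "\<And>s t. s \<in> T \<Longrightarrow> t \<in> T \<Longrightarrow> s + t \<in> T"
    and "d \<ge> 1"
    and "\<And>t. t \<in> T \<Longrightarrow> u t \<in> carrier_vec d"
    and "covariance_function T k"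
    and "psd_mat d \<Lambda>"
    and "mgp P T d f u k \<Lambda>"
    and "\<And>t h. t \<in> T \<Longrightarrow> h \<in> T \<Longrightarrow> u t = u (t + h)"
    and "\<And>s l h. s \<in> T \<Longrightarrow> l \<in> T \<Longrightarrow> h \<in> T \<Longrightarrow> k (s + h) (l + h) = k s l"
  shows "strictly_stationary P T d f"
proof -
  have proc: "vector_process P T d f"
    and fdd: "\<And>ts. ts \<noteq> [] \<Longrightarrow> set ts \<subseteq> T \<Longrightarrow>
      matrix_normal P (\<lambda>\<omega>. mat_of_rows d (map (\<lambda>t. f t \<omega>) ts)) (mat_of_rows d (map u ts)) (gram_mat k ts) \<Lambda>"
    using assms(6) by (auto simp: mgp_def)
  have P: "prob_space P" using proc by (simp add: vector_process_def)
  show ?thesis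
    unfolding strictly_stationary_def
  proof (intro conjI proc allI impI)
    fix ts h assume ts: "ts \<noteq> []" "set ts \<subseteq> T" and h: "h \<in> T"
    \<comment> \<open>The Gaussian property is applied to the shifted index list, which closure
      under addition keeps in \<open>T\<close>. Lists may repeat entries, so the shift need not be
      injective.\<close>
    let ?ts = "map (\<lambda>t. t + h) ts"
    have "map (\<lambda>t. u (t + h)) ts = map u ts"
      using ts h assms(7) by auto
    moreover have "gram_mat k ?ts = gram_mat k ts"
      using ts h assms(8) by (auto simp: gram_mat_def subset_iff intro!: cong_mat)
    moreover have "set ?ts \<subseteq> T" "?ts \<noteq> []"
      using ts h assms(1) by auto
    \<comment> \<open>Invariance of \<open>u\<close> and \<open>k\<close> turns the parameters of
      the shifted matrix into those of the original one.\<close>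
    ultimately have "matrix_normal P (\<lambda>\<omega>. mat_of_rows d (map (\<lambda>t. f (t + h) \<omega>) ts))
        (mat_of_rows d (map u ts)) (gram_mat k ts) \<Lambda>"
      using fdd[of ?ts] by (simp add: comp_def del: map_eq_conv)
    moreover have "mat_of_rows d (map u ts) \<in> carrier_mat (length ts) d"
      using mat_of_rows_carrier(1)[of d "map u ts"] by simp
    ultimately show "distr P (borel_mat (length ts) d) (\<lambda>\<omega>. mat_of_rows d (map (\<lambda>t. f (t + h) \<omega>) ts)) =
        distr P (borel_mat (length ts) d) (\<lambda>\<omega>. mat_of_rows d (map (\<lambda>t. f t \<omega>) ts))"
      by (intro matrix_normal_distr_unique[OF P P _ _ fdd[OF ts]])
  qed
qed

end
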